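(* Let $\mathbb G$ be an affine group scheme of finite type over $k$ and let $X \subset \mathcal O(\mathbb G)$ be a $k$-subspace. Then there is a smallest subcoalgebra $\mathcal O(\mathbb G)_{\langle X\rangle} \subset \mathcal O(\mathbb G)$ containing $X$, given by $$\mathcal O(\mathbb G)_{\langle X \rangle} \equiv k\mathbb G^{op} \cdot (k\mathbb G \cdot X).$$ If $X$ is finite dimensional, then $\mathcal O(\mathbb G)_{\langle X \rangle}$ is also finite dimensional. Consequently, for any ascending converging sequence $\{X_i\}$ of finite dimensional subspaces of $\mathcal O(\mathbb G)$, there is a smallest ascending converging sequence $\{\mathcal O(\mathbb G)_{\langle X_i \rangle}\}$ of finite dimensional subcoalgebras of $\mathcal O(\mathbb G)$ satisfying the condition that $X_i \subset \mathcal O(\mathbb G)_{\langle X_i\rangle}$ for all $i$.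
   Context: $k$ is a field of characteristic $p>0$ and $\mathcal O(\mathbb G)$ is the coordinate algebra of $\mathbb G$, regarded as a coalgebra over $k$. $k\mathbb G\cdot X$ denotes the smallest $\mathbb G$-submodule containing $X$ of the right regular representation of $\mathbb G$ on $\mathcal O(\mathbb G)$ (in which $g$ acts by $f(-)\mapsto f(-\,g)$). For a subspace $Y$ of $\mathcal O(\mathbb G)=\mathcal O(\mathbb G^{op})$ (identified as vector spaces, $\mathbb G^{op}$ being the opposite group scheme), $k\mathbb G^{op}\cdot Y$ denotes the smallest $\mathbb G^{op}$-submodule containing $Y$ of the right regular representation of $\mathbb G^{op}$ on $\mathcal O(\mathbb G^{op})$ (in which $g$ acts by $f(-)\mapsto f(g\,-)$). An ascending converging sequence of subspaces of $\mathcal O(\mathbb G)$ is a sequence of $k$-subspaces $\{X_i\}_{i\geq 0}$ with $X_i \subset X_{i+1}$ for all $i\ge 0$ and $\bigcup_{i\geq 0} X_i = \mathcal O(\mathbb G)$. *)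

theory Defs
  imports "HOL.Vector_Spaces" "HOL-Library.Poly_Mapping"
begin

section \<open>Formal sums and tensor products over a field\<close>

text \<open>
  Since the scalar multiplication \<open>'k \<Rightarrow> 'a \<Rightarrow> 'a\<close> of a vector space is a term, the tensor product
  cannot be a type.  Elements of \<open>A \<otimes> B\<close> are therefore represented by elements of
  the free vector space on \<open>A \<times> B\<close>, and equality in \<open>A \<otimes> B\<close> is congruence modulo the
  subspace spanned by the usual bilinearity relations; likewise for \<open>A \<otimes> B \<otimes> C\<close>.
\<close>

definition fscale :: "'k::field \<Rightarrow> ('x \<Rightarrow>\<^sub>0 'k) \<Rightarrow> ('x \<Rightarrow>\<^sub>0 'k)"
  where "fscale c x = Poly_Mapping.map ((*) c) x"

text \<open>The linear extension of \<open>f\<close> from the basis to all formal sums.\<close>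

definition lin_ext :: "('k::field \<Rightarrow> 'v::ab_group_add \<Rightarrow> 'v) \<Rightarrow> ('x \<Rightarrow> 'v) \<Rightarrow> ('x \<Rightarrow>\<^sub>0 'k) \<Rightarrow> 'v"
  where "lin_ext s f x = (\<Sum>i\<in>Poly_Mapping.keys x. s (Poly_Mapping.lookup x i) (f i))"

abbreviation pure :: "'x \<Rightarrow> ('x \<Rightarrow>\<^sub>0 'k::field)"
  where "pure i \<equiv> Poly_Mapping.single i 1"

definition tensor_rels ::
  "('k::field \<Rightarrow> 'a::ab_group_add \<Rightarrow> 'a) \<Rightarrow> ('k \<Rightarrow> 'b::ab_group_add \<Rightarrow> 'b) \<Rightarrow> (('a \<times> 'b) \<Rightarrow>\<^sub>0 'k) set"
  where "tensor_rels sA sB = module.span fscale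
     ({pure (a + a', b) - pure (a, b) - pure (a', b) | a a' b. True} \<union>
      {pure (a, b + b') - pure (a, b) - pure (a, b') | a b b'. True} \<union>
      {pure (sA c a, b) - fscale c (pure (a, b)) | c a b. True} \<union>
      {pure (a, sB c b) - fscale c (pure (a, b)) | c a b. True})"

definition tensor_eq ::
  "('k::field \<Rightarrow> 'a::ab_group_add \<Rightarrow> 'a) \<Rightarrow> ('k \<Rightarrow> 'b::ab_group_add \<Rightarrow> 'b) \<Rightarrow>
   (('a \<times> 'b) \<Rightarrow>\<^sub>0 'k) \<Rightarrow> (('a \<times> 'b) \<Rightarrow>\<^sub>0 'k) \<Rightarrow> bool"
  where "tensor_eq sA sB x y \<longleftrightarrow> x - y \<in> tensor_rels sA sB"

definition tensor3_rels ::
  "('k::field \<Rightarrow> 'a::ab_group_add \<Rightarrow> 'a) \<Rightarrow> ('k \<Rightarrow> 'b::ab_group_add \<Rightarrow> 'b) \<Rightarrow>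
   ('k \<Rightarrow> 'c::ab_group_add \<Rightarrow> 'c) \<Rightarrow> (('a \<times> 'b \<times> 'c) \<Rightarrow>\<^sub>0 'k) set"
  where "tensor3_rels sA sB sC = module.span fscale
     ({pure (a + a', b, c) - pure (a, b, c) - pure (a', b, c) | a a' b c. True} \<union>
      {pure (a, b + b', c) - pure (a, b, c) - pure (a, b', c) | a b b' c. True} \<union>
      {pure (a, b, c + c') - pure (a, b, c) - pure (a, b, c') | a b c c'. True} \<union>
      {pure (sA r a, b, c) - fscale r (pure (a, b, c)) | r a b c. True} \<union>
      {pure (a, sB r b, c) - fscale r (pure (a, b, c)) | r a b c. True} \<union>
      {pure (a, b, sC r c) - fscale r (pure (a, b, c)) | r a b c. True})"

definition tensor3_eq ::
  "('k::field \<Rightarrow> 'a::ab_group_add \<Rightarrow> 'a) \<Rightarrow> ('k \<Rightarrow> 'b::ab_group_add \<Rightarrow> 'b) \<Rightarrow>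
   ('k \<Rightarrow> 'c::ab_group_add \<Rightarrow> 'c) \<Rightarrow>
   (('a \<times> 'b \<times> 'c) \<Rightarrow>\<^sub>0 'k) \<Rightarrow> (('a \<times> 'b \<times> 'c) \<Rightarrow>\<^sub>0 'k) \<Rightarrow> bool"
  where "tensor3_eq sA sB sC x y \<longleftrightarrow> x - y \<in> tensor3_rels sA sB sC"

text \<open>The image of \<open>V \<otimes> W\<close> in \<open>A \<otimes> B\<close>, for subspaces \<open>V\<close> of \<open>A\<close> and \<open>W\<close> of \<open>B\<close>.\<close>

definition tensor_sub ::
  "('k::field \<Rightarrow> 'a::ab_group_add \<Rightarrow> 'a) \<Rightarrow> ('k \<Rightarrow> 'b::ab_group_add \<Rightarrow> 'b) \<Rightarrow>
   'a set \<Rightarrow> 'b set \<Rightarrow> (('a \<times> 'b) \<Rightarrow>\<^sub>0 'k) set"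
  where "tensor_sub sA sB V W = {t. \<exists>x. Poly_Mapping.keys x \<subseteq> V \<times> W \<and> tensor_eq sA sB t x}"

definition tensor_swap :: "(('a \<times> 'b) \<Rightarrow>\<^sub>0 'k::field) \<Rightarrow> (('b \<times> 'a) \<Rightarrow>\<^sub>0 'k)"
  where "tensor_swap = lin_ext fscale (\<lambda>(a, b). pure (b, a))"

text \<open>The product of \<open>A \<otimes> B\<close>: \<open>(a \<otimes> b) (a' \<otimes> b') = a a' \<otimes> b b'\<close>.\<close>

definition tensor_times ::
  "(('a::times \<times> 'b::times) \<Rightarrow>\<^sub>0 'k::field) \<Rightarrow> (('a \<times> 'b) \<Rightarrow>\<^sub>0 'k) \<Rightarrow> (('a \<times> 'b) \<Rightarrow>\<^sub>0 'k)"
  where "tensor_times x y =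
    lin_ext fscale (\<lambda>(a, b). lin_ext fscale (\<lambda>(a', b'). pure (a * a', b * b')) y) x"


section \<open>Affine group schemes\<close>

definition comm_algebra :: "('k::field \<Rightarrow> 'a::comm_ring_1 \<Rightarrow> 'a) \<Rightarrow> bool"
  where "comm_algebra s \<longleftrightarrow> vector_space s \<and> (\<forall>c a b. s c (a * b) = s c a * b)"

definition algebra_hom ::
  "('k::field \<Rightarrow> 'a::comm_ring_1 \<Rightarrow> 'a) \<Rightarrow> ('k \<Rightarrow> 'b::comm_ring_1 \<Rightarrow> 'b) \<Rightarrow> ('a \<Rightarrow> 'b) \<Rightarrow> bool"
  where "algebra_hom sA sB h \<longleftrightarrow>
    Vector_Spaces.linear sA sB h \<and> h 1 = 1 \<and> (\<forall>a b. h (a * b) = h a * h b)"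

text \<open>
  An affine group scheme is given by its coordinate algebra, a commutative Hopf algebra.  The
  coordinate algebra is the whole type \<open>'a\<close>; the comultiplication, the counit and the antipode are
  the comorphisms of multiplication, unit and inversion.  The field \<open>comul\<close> assigns to \<open>f\<close>
  a formal sum representing its comultiplication; all conditions on it are imposed in the
  tensor product, so the choice of representatives is immaterial.
\<close>

record (overloaded) ('k::zero, 'a) group_scheme =
  scale :: "'k \<Rightarrow> 'a \<Rightarrow> 'a"
  comul :: "'a \<Rightarrow> (('a \<times> 'a) \<Rightarrow>\<^sub>0 'k)"
  counit :: "'a \<Rightarrow> 'k"
  antipode :: "'a \<Rightarrow> 'a"

locale affine_group_scheme =
  fixes G :: "('k::field, 'a::comm_ring_1) group_scheme"
  assumes algebra: "comm_algebra (scale G)"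
    and comul_add: "tensor_eq (scale G) (scale G) (comul G (f + h)) (comul G f + comul G h)"
    and comul_scale: "tensor_eq (scale G) (scale G) (comul G (scale G c f)) (fscale c (comul G f))"
    and comul_one: "tensor_eq (scale G) (scale G) (comul G 1) (pure (1, 1))"
    and comul_mult:
      "tensor_eq (scale G) (scale G) (comul G (f * h)) (tensor_times (comul G f) (comul G h))"
    and counit_hom: "algebra_hom (scale G) (*) (counit G)"
    and antipode_hom: "algebra_hom (scale G) (scale G) (antipode G)"
    and coassoc: "tensor3_eq (scale G) (scale G) (scale G)
      (lin_ext fscale (\<lambda>(a, b). lin_ext fscale (\<lambda>(a', a''). pure (a', a'', b)) (comul G a)) (comul G f))
      (lin_ext fscale (\<lambda>(a, b). lin_ext fscale (\<lambda>(b', b''). pure (a, b', b'')) (comul G b)) (comul G f))"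
    and counit_left: "lin_ext (scale G) (\<lambda>(a, b). scale G (counit G a) b) (comul G f) = f"
    and counit_right: "lin_ext (scale G) (\<lambda>(a, b). scale G (counit G b) a) (comul G f) = f"
    and antipode_left:
      "lin_ext (scale G) (\<lambda>(a, b). antipode G a * b) (comul G f) = scale G (counit G f) 1"
    and antipode_right:
      "lin_ext (scale G) (\<lambda>(a, b). a * antipode G b) (comul G f) = scale G (counit G f) 1"

definition subalgebra :: "('k::field \<Rightarrow> 'a::comm_ring_1 \<Rightarrow> 'a) \<Rightarrow> 'a set \<Rightarrow> bool"
  where "subalgebra s B \<longleftrightarrow> module.subspace s B \<and> 1 \<in> B \<and> (\<forall>a\<in>B. \<forall>b\<in>B. a * b \<in> B)"

definition finite_type :: "('k::field, 'a::comm_ring_1) group_scheme \<Rightarrow> bool"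
  where "finite_type G \<longleftrightarrow> (\<exists>S. finite S \<and> subalgebra (scale G) hull S = UNIV)"

text \<open>The inversion of the opposite group scheme is that of the group scheme itself.\<close>

definition opposite :: "('k::field, 'a::comm_ring_1) group_scheme \<Rightarrow> ('k, 'a) group_scheme"
  where "opposite G = G\<lparr>comul := (\<lambda>f. tensor_swap (comul G f))\<rparr>"


section \<open>Submodules of the regular representation and subcoalgebras\<close>

text \<open>
  Rational modules are comodules over the coordinate algebra.  If \<open>f\<close> has comultiplication
  \<open>\<Sum> f\<^sub>i \<otimes> h\<^sub>i\<close>, then \<open>f (x g) = \<Sum> f\<^sub>i (x) h\<^sub>i (g)\<close>: hence the coaction of the right regular
  representation is the comultiplication, and a submodule is a subspace \<open>V\<close> on which the
  coaction takes values in \<open>V \<otimes> A\<close>, \<open>A\<close> being the coordinate algebra.  See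
  \<open>regular_submodule_iff_point_stable\<close> and \<open>regular_submodule_point_action\<close> below for the
  description by points.
\<close>

definition regular_submodule :: "('k::field, 'a::comm_ring_1) group_scheme \<Rightarrow> 'a set \<Rightarrow> bool"
  where "regular_submodule G V \<longleftrightarrow>
    module.subspace (scale G) V \<and>
    (\<forall>f\<in>V. comul G f \<in> tensor_sub (scale G) (scale G) V UNIV)"

text \<open>The smallest submodule of the right regular representation containing \<open>X\<close>.\<close>

definition submodule_gen :: "('k::field, 'a::comm_ring_1) group_scheme \<Rightarrow> 'a set \<Rightarrow> 'a set"
  where "submodule_gen G X = (LEAST V. regular_submodule G V \<and> X \<subseteq> V)"

definition subcoalgebra :: "('k::field, 'a::comm_ring_1) group_scheme \<Rightarrow> 'a set \<Rightarrow> bool"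
  where "subcoalgebra G C \<longleftrightarrow>
    module.subspace (scale G) C \<and>
    (\<forall>f\<in>C. comul G f \<in> tensor_sub (scale G) (scale G) C C)"

definition subcoalgebra_gen :: "('k::field, 'a::comm_ring_1) group_scheme \<Rightarrow> 'a set \<Rightarrow> 'a set"
  where "subcoalgebra_gen G X = (LEAST C. subcoalgebra G C \<and> X \<subseteq> C)"

definition fin_dim :: "('k::field \<Rightarrow> 'a::ab_group_add \<Rightarrow> 'a) \<Rightarrow> 'a set \<Rightarrow> bool"
  where "fin_dim s V \<longleftrightarrow> (\<exists>B. finite B \<and> V = module.span s B)"

definition ascending_converging ::
  "('k::field, 'a::comm_ring_1) group_scheme \<Rightarrow> (nat \<Rightarrow> 'a set) \<Rightarrow> bool"
  where "ascending_converging G X \<longleftrightarrow>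
    (\<forall>i. module.subspace (scale G) (X i)) \<and> (\<forall>i. X i \<subseteq> X (Suc i)) \<and> (\<Union>i. X i) = UNIV"

text \<open>For sequences of sets, \<open>\<le>\<close> is termwise inclusion.\<close>

definition is_smallest :: "('x::order \<Rightarrow> bool) \<Rightarrow> 'x \<Rightarrow> bool"
  where "is_smallest P x \<longleftrightarrow> P x \<and> (\<forall>y. P y \<longrightarrow> x \<le> y)"


section \<open>Submodules in terms of points\<close>

text \<open>
  A point \<open>g\<close> with values in an algebra \<open>R\<close> is an algebra homomorphism \<open>A \<rightarrow> R\<close>;
  it sends \<open>f\<close> to \<open>f (- g)\<close>, an element of \<open>A \<otimes> R\<close>.
\<close>

definition base_change ::
  "('b \<Rightarrow> 'r) \<Rightarrow> (('a \<times> 'b) \<Rightarrow>\<^sub>0 'k::field) \<Rightarrow> (('a \<times> 'r) \<Rightarrow>\<^sub>0 'k)"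
  where "base_change g = lin_ext fscale (\<lambda>(a, b). pure (a, g b))"

definition point_action ::
  "('k::field, 'a::comm_ring_1) group_scheme \<Rightarrow> ('a \<Rightarrow> 'r) \<Rightarrow> 'a \<Rightarrow> (('a \<times> 'r) \<Rightarrow>\<^sub>0 'k)"
  where "point_action G g f = base_change g (comul G f)"

lemma lookup_fscale: "Poly_Mapping.lookup (fscale c x) i = c * Poly_Mapping.lookup x i"
  by (simp add: fscale_def Poly_Mapping.map.rep_eq when_def)

interpretation fscale: vector_space "fscale :: 'k::field \<Rightarrow> ('x \<Rightarrow>\<^sub>0 'k) \<Rightarrow> _"
  by unfold_locales
    (auto intro!: poly_mapping_eqI simp: lookup_fscale lookup_add algebra_simps)

lemma lin_ext_fscale_linear:
  fixes f :: "'x \<Rightarrow> ('y \<Rightarrow>\<^sub>0 'k::field)"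
  shows "Vector_Spaces.linear fscale fscale (lin_ext fscale f)"
proof -
  have ext: "lin_ext fscale f x = (\<Sum>i\<in>S. fscale (Poly_Mapping.lookup x i) (f i))"
    if "finite S" "Poly_Mapping.keys x \<subseteq> S" for x S
    unfolding lin_ext_def
    by (rule sum.mono_neutral_left) (use that in \<open>auto simp: in_keys_iff\<close>)
  show ?thesis
  proof (unfold_locales, goal_cases)
    case (1 x y)
    let ?S = "Poly_Mapping.keys x \<union> Poly_Mapping.keys y"
    have "Poly_Mapping.keys (x + y) \<subseteq> ?S" by (rule Poly_Mapping.keys_add)
    then show ?case
      by (simp add: ext[of ?S] lookup_add fscale.scale_left_distrib sum.distrib)
  next
    case (2 c x)
    have "Poly_Mapping.keys (fscale c x) \<subseteq> Poly_Mapping.keys x"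
      by (auto simp: in_keys_iff lookup_fscale)
    then show ?case
      by (simp add: ext[of "Poly_Mapping.keys x"] lookup_fscale fscale.scale_sum_right)
  qed
qed

lemma tensor_eq_base_change:
  fixes sA :: "'k::field \<Rightarrow> 'a::ab_group_add \<Rightarrow> 'a"
  assumes g: "Vector_Spaces.linear sB sR g" and eq: "tensor_eq sA sB x y"
  shows "tensor_eq sA sR (base_change g x) (base_change g y)"
proof -
  let ?F = "base_change g :: (('a \<times> _) \<Rightarrow>\<^sub>0 'k) \<Rightarrow> _"
  have F: "Vector_Spaces.linear fscale fscale ?F"
    unfolding base_change_def by (rule lin_ext_fscale_linear)
  then interpret F: module_hom fscale fscale ?F
    by (simp add: module_hom_iff_linear)
  have g': "module_hom sB sR g"
    using g by (simp add: module_hom_iff_linear)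
  have F_pure: "?F (pure (a, b)) = pure (a, g b)" for a b
    by (simp add: base_change_def lin_ext_def)
  note F_simps = F.diff F.scale F_pure module_hom.add[OF g'] module_hom.scale[OF g']
  have gen: "?F x \<in> tensor_rels sA sR" if "x \<in>
       ({pure (a + a', b) - pure (a, b) - pure (a', b) | a a' b. True} \<union>
        {pure (a, b + b') - pure (a, b) - pure (a, b') | a b b'. True} \<union>
        {pure (sA c a, b) - fscale c (pure (a, b)) | c a b. True} \<union>
        {pure (a, sB c b) - fscale c (pure (a, b)) | c a b. True})" for x
    unfolding tensor_rels_def
    by (rule fscale.span_base, use that in \<open>elim UnE CollectE exE conjE\<close>; simp only: F_simps; blast)
  have "?F z \<in> tensor_rels sA sR" if "z \<in> tensor_rels sA sB" for z
    using that unfolding tensor_rels_def[of sA sB]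
  proof (induction rule: fscale.span_induct_alt)
    case base
    show ?case
      unfolding F.zero tensor_rels_def by (rule fscale.span_zero)
  next
    case (step c x y)
    show ?case
      using gen[OF step(1)] step(2)
      unfolding F.add F.scale tensor_rels_def
      by (intro fscale.span_add fscale.span_scale)
  qed
  then show ?thesis
    using eq unfolding tensor_eq_def F.diff[symmetric] by blast
qed

lemma regular_submodule_point_action:
  assumes "regular_submodule G V" and "algebra_hom (scale G) sR g" and "f \<in> V"
  shows "point_action G g f \<in> tensor_sub (scale G) sR V UNIV"
proof -
  obtain x where x: "Poly_Mapping.keys x \<subseteq> V \<times> UNIV"
    and eq: "tensor_eq (scale G) (scale G) (comul G f) x"
    using assms(1,3) unfolding regular_submodule_def tensor_sub_def by blast
  have "Poly_Mapping.keys (base_change g x) \<subseteq> V \<times> UNIV"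
  proof
    fix i assume "i \<in> Poly_Mapping.keys (base_change g x)"
    then obtain j where j: "j \<in> Poly_Mapping.keys x"
      "i \<in> Poly_Mapping.keys (fscale (Poly_Mapping.lookup x j) (case j of (a, b) \<Rightarrow> pure (a, g b)))"
      unfolding base_change_def lin_ext_def
      by (elim UN_E[OF subsetD[OF Poly_Mapping.keys_sum]])
    obtain a b where ab: "j = (a, b)" by (cases j)
    have "i = (a, g b)"
      using j(2) unfolding ab by (auto simp: in_keys_iff lookup_fscale lookup_single when_def
        split: if_splits)
    then show "i \<in> V \<times> UNIV"
      using x j(1) ab by blast
  qed
  moreover have "tensor_eq (scale G) sR (point_action G g f) (base_change g x)"
    unfolding point_action_def
    by (rule tensor_eq_base_change[OF _ eq]) (use assms(2) in \<open>simp add: algebra_hom_def\<close>)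
  ultimately show ?thesis
    unfolding tensor_sub_def by blast
qed

text \<open>Conversely, stability under the generic point, the identity of \<open>A\<close>, suffices.\<close>

lemma regular_submodule_iff_point_stable:
  fixes G :: "('k::field, 'a::comm_ring_1) group_scheme"
  assumes "affine_group_scheme G"
  shows "regular_submodule G V \<longleftrightarrow>
    module.subspace (scale G) V \<and>
    (\<forall>(sR :: 'k \<Rightarrow> 'a \<Rightarrow> 'a) g. comm_algebra sR \<and> algebra_hom (scale G) sR g \<longrightarrow>
      (\<forall>f\<in>V. point_action G g f \<in> tensor_sub (scale G) sR V UNIV))"
    (is "_ \<longleftrightarrow> ?sub \<and> ?stable")
proof -
  have alg: "comm_algebra (scale G)"
    using assms by (rule affine_group_scheme.algebra)
  then interpret vector_space "scale G"
    by (simp add: comm_algebra_def)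
  have hom: "algebra_hom (scale G) (scale G) (\<lambda>a. a)"
    unfolding algebra_hom_def using linear_ident by simp
  have "fscale c (pure i) = Poly_Mapping.single i c" for c :: 'k and i :: "'a \<times> 'a"
    by (rule poly_mapping_eqI) (simp add: lookup_fscale lookup_single when_def)
  then have id: "point_action G (\<lambda>a. a) f = comul G f" for f
    unfolding point_action_def base_change_def lin_ext_def
    by (auto intro!: poly_mapping_eqI
      simp: lookup_sum lookup_single when_def in_keys_iff case_prod_beta)
  show ?thesis
  proof
    assume "regular_submodule G V"
    then show "?sub \<and> ?stable"
      by (blast intro: regular_submodule_point_action dest: regular_submodule_def[THEN iffD1])
  next
    assume *: "?sub \<and> ?stable"
    then have "\<forall>f\<in>V. point_action G (\<lambda>a. a) f \<in> tensor_sub (scale G) (scale G) V UNIV"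
      using alg hom by blast
    then show "regular_submodule G V"
      using * by (simp add: id regular_submodule_def)
  qed
qed

end

theory Submission
  imports Defs
begin

text \<open>
  Contracting the second factor of the comultiplication \<open>\<Sum> f\<^sub>i \<otimes> h\<^sub>i\<close> of \<open>f\<close> with a linear functional
  \<open>\<phi>\<close> gives the element \<open>\<Sum> \<phi> (h\<^sub>i) f\<^sub>i\<close> of the coordinate algebra, the right translate of \<open>f\<close> by the
  generalised point \<open>\<phi>\<close>; contracting the first factor gives the left translate.  All three notions in
  the theorem are conditions on translates.  The reason is \<open>tensor_sub_iff_slices\<close>: over a field, a
  tensor lies in \<open>V \<otimes> W\<close> if and only if contracting its second factor always gives an element of \<open>V\<close>
  and contracting its first factor always gives an element of \<open>W\<close>.  Hence a
  subspace is a submodule for \<open>G\<close>, a submodule for the opposite group, or a subcoalgebra if and only if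
  it is stable under right translations, under left translations, or under both, respectively.

  Coassociativity, contracted with functionals in two of the three factors, says that a composite of
  right translations is a right translation by a convolution, the same for left translations, and that
  left translations commute with right ones.  By the first two facts and the counit axioms, the smallest
  stable subspace containing \<open>X\<close> is the span of the translates of \<open>X\<close>
  (\<open>is_smallest_stable_span\<close>).  By the third, the left translates of a right stable subspace still span a
  right stable subspace, so that \<open>submodule_gen (opposite G) (submodule_gen G X)\<close> is stable on both
  sides; it is contained in every subcoalgebra containing \<open>X\<close>, hence is the smallest one.

  Finiteness holds because the comultiplication of \<open>f\<close> is a finite sum: all right translates of \<open>f\<close> lie
  in the span of the finitely many \<open>f\<^sub>i\<close>, and all left translates in that of the \<open>h\<^sub>i\<close>.
\<close>

section \<open>Linear and multilinear maps on formal sums\<close>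

lemma linear_lin_ext:
  fixes f :: "'x \<Rightarrow> 'v::ab_group_add"
  assumes "vector_space s"
  shows "Vector_Spaces.linear fscale s (lin_ext s f)"
proof -
  interpret vector_space s by fact
  have ext: "lin_ext s f x = (\<Sum>i\<in>S. s (Poly_Mapping.lookup x i) (f i))"
    if "finite S" "Poly_Mapping.keys x \<subseteq> S" for x S
    unfolding lin_ext_def
    by (rule sum.mono_neutral_left) (use that in \<open>auto simp: in_keys_iff\<close>)
  have "lin_ext s f (x + y) = lin_ext s f x + lin_ext s f y" for x y
    using Poly_Mapping.keys_add[of x y]
    by (simp add: ext[of "Poly_Mapping.keys x \<union> Poly_Mapping.keys y"] lookup_add
        scale_left_distrib sum.distrib)
  moreover have "lin_ext s f (fscale c x) = s c (lin_ext s f x)" for c x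
  proof -
    have "Poly_Mapping.keys (fscale c x) \<subseteq> Poly_Mapping.keys x"
      by (auto simp: in_keys_iff lookup_fscale)
    then show ?thesis
      by (simp add: ext[of "Poly_Mapping.keys x"] lookup_fscale scale_sum_right)
  qed
  ultimately show ?thesis
    by (simp add: Vector_Spaces.linear_iff vector_space_axioms fscale.vector_space_axioms)
qed

lemma lin_ext_pure:
  assumes "vector_space s"
  shows "lin_ext s f (pure i) = f i"
proof -
  interpret vector_space s by fact
  show ?thesis by (simp add: lin_ext_def)
qed

lemma linear_lin_ext_comp:
  assumes "Vector_Spaces.linear s s' h"
  shows "h (lin_ext s f x) = lin_ext s' (\<lambda>i. h (f i)) x"
proof -
  interpret h: Vector_Spaces.linear s s' h by fact
  show ?thesis by (simp add: lin_ext_def h.sum h.scale)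
qed

lemma lin_ext_in_subspace:
  assumes "vector_space s" and "module.subspace s V"
    and "\<And>i. i \<in> Poly_Mapping.keys x \<Longrightarrow> f i \<in> V"
  shows "lin_ext s f x \<in> V"
proof -
  interpret vector_space s by fact
  show ?thesis
    unfolding lin_ext_def using assms(2,3) by (intro subspace_sum subspace_scale) auto
qed

definition bilinear_on_pairs ::
  "('k::field \<Rightarrow> 'a::ab_group_add \<Rightarrow> 'a) \<Rightarrow> ('k \<Rightarrow> 'b::ab_group_add \<Rightarrow> 'b) \<Rightarrow>
   ('k \<Rightarrow> 'v::ab_group_add \<Rightarrow> 'v) \<Rightarrow> ('a \<times> 'b \<Rightarrow> 'v) \<Rightarrow> bool"
  where "bilinear_on_pairs sA sB s f \<longleftrightarrow>
    (\<forall>a a' b. f (a + a', b) = f (a, b) + f (a', b)) \<and>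
    (\<forall>a b b'. f (a, b + b') = f (a, b) + f (a, b')) \<and>
    (\<forall>c a b. f (sA c a, b) = s c (f (a, b))) \<and>
    (\<forall>c a b. f (a, sB c b) = s c (f (a, b)))"

definition trilinear_on_triples ::
  "('k::field \<Rightarrow> 'a::ab_group_add \<Rightarrow> 'a) \<Rightarrow> ('k \<Rightarrow> 'b::ab_group_add \<Rightarrow> 'b) \<Rightarrow>
   ('k \<Rightarrow> 'c::ab_group_add \<Rightarrow> 'c) \<Rightarrow> ('k \<Rightarrow> 'v::ab_group_add \<Rightarrow> 'v) \<Rightarrow> ('a \<times> 'b \<times> 'c \<Rightarrow> 'v) \<Rightarrow> bool"
  where "trilinear_on_triples sA sB sC s f \<longleftrightarrow>
    (\<forall>a a' b c. f (a + a', b, c) = f (a, b, c) + f (a', b, c)) \<and>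
    (\<forall>a b b' c. f (a, b + b', c) = f (a, b, c) + f (a, b', c)) \<and>
    (\<forall>a b c c'. f (a, b, c + c') = f (a, b, c) + f (a, b, c')) \<and>
    (\<forall>r a b c. f (sA r a, b, c) = s r (f (a, b, c))) \<and>
    (\<forall>r a b c. f (a, sB r b, c) = s r (f (a, b, c))) \<and>
    (\<forall>r a b c. f (a, b, sC r c) = s r (f (a, b, c)))"

text \<open>
  The universal property of the tensor product of two spaces, and of three: the linear extension of a
  multilinear map kills the generators of the relations.
\<close>

lemma lin_ext_tensor_eq:
  assumes "vector_space s" and "bilinear_on_pairs sA sB s f" and "tensor_eq sA sB x y"
  shows "lin_ext s f x = lin_ext s f y"
proof -
  interpret F: Vector_Spaces.linear fscale s "lin_ext s f"
    by (rule linear_lin_ext) fact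
  have "lin_ext s f (x - y) = 0"
    using assms(3) unfolding tensor_eq_def tensor_rels_def
    by (rule F.eq_0_on_span[rotated])
      (use assms(2) in \<open>auto simp: bilinear_on_pairs_def F.diff F.scale lin_ext_pure[OF assms(1)]\<close>)
  then show ?thesis by (simp add: F.diff)
qed

lemma lin_ext_tensor3_eq:
  assumes "vector_space s" and "trilinear_on_triples sA sB sC s f" and "tensor3_eq sA sB sC x y"
  shows "lin_ext s f x = lin_ext s f y"
proof -
  interpret F: Vector_Spaces.linear fscale s "lin_ext s f"
    by (rule linear_lin_ext) fact
  have "lin_ext s f (x - y) = 0"
    using assms(3) unfolding tensor3_eq_def tensor3_rels_def
    by (rule F.eq_0_on_span[rotated])
      (use assms(2) in \<open>auto simp: trilinear_on_triples_def F.diff F.scale lin_ext_pure[OF assms(1)]\<close>)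
  then show ?thesis by (simp add: F.diff)
qed


section \<open>Contractions and membership in a tensor product of subspaces\<close>

definition slice_right ::
  "('k::field \<Rightarrow> 'a::ab_group_add \<Rightarrow> 'a) \<Rightarrow> ('b \<Rightarrow> 'k) \<Rightarrow> (('a \<times> 'b) \<Rightarrow>\<^sub>0 'k) \<Rightarrow> 'a"
  where "slice_right sA \<phi> = lin_ext sA (\<lambda>(a, b). sA (\<phi> b) a)"

definition slice_left ::
  "('k::field \<Rightarrow> 'b::ab_group_add \<Rightarrow> 'b) \<Rightarrow> ('a \<Rightarrow> 'k) \<Rightarrow> (('a \<times> 'b) \<Rightarrow>\<^sub>0 'k) \<Rightarrow> 'b"
  where "slice_left sB \<phi> = lin_ext sB (\<lambda>(a, b). sB (\<phi> a) b)"

lemma bilinear_slice_right: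
  assumes "vector_space sA" and "Vector_Spaces.linear sB (*) \<phi>"
  shows "bilinear_on_pairs sA sB sA (\<lambda>(a, b). sA (\<phi> b) a)"
proof -
  interpret vector_space sA by fact
  interpret \<phi>: Vector_Spaces.linear sB "(*)" \<phi> by fact
  show ?thesis
    by (simp add: bilinear_on_pairs_def \<phi>.add \<phi>.scale scale_right_distrib scale_left_distrib mult.commute)
qed

lemma bilinear_slice_left:
  assumes "vector_space sB" and "Vector_Spaces.linear sA (*) \<phi>"
  shows "bilinear_on_pairs sA sB sB (\<lambda>(a, b). sB (\<phi> a) b)"
proof -
  interpret vector_space sB by fact
  interpret \<phi>: Vector_Spaces.linear sA "(*)" \<phi> by fact
  show ?thesis
    by (simp add: bilinear_on_pairs_def \<phi>.add \<phi>.scale scale_right_distrib scale_left_distrib mult.commute)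
qed

lemma slice_right_tensor_eq:
  assumes "vector_space sA" and "Vector_Spaces.linear sB (*) \<phi>" and "tensor_eq sA sB x y"
  shows "slice_right sA \<phi> x = slice_right sA \<phi> y"
  unfolding slice_right_def
  using assms(1) bilinear_slice_right[OF assms(1,2)] assms(3) by (rule lin_ext_tensor_eq)

lemma slice_left_tensor_eq:
  assumes "vector_space sB" and "Vector_Spaces.linear sA (*) \<phi>" and "tensor_eq sA sB x y"
  shows "slice_left sB \<phi> x = slice_left sB \<phi> y"
  unfolding slice_left_def
  using assms(1) bilinear_slice_left[OF assms(1,2)] assms(3) by (rule lin_ext_tensor_eq)

lemma functional_slice_swap:
  assumes "Vector_Spaces.linear sA (*) \<phi>" and "Vector_Spaces.linear sB (*) \<psi>"
  shows "\<psi> (slice_left sB \<phi> x) = \<phi> (slice_right sA \<psi> x)"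
proof -
  interpret \<phi>: Vector_Spaces.linear sA "(*)" \<phi> by fact
  interpret \<psi>: Vector_Spaces.linear sB "(*)" \<psi> by fact
  show ?thesis
    unfolding slice_left_def slice_right_def linear_lin_ext_comp[OF assms(1)] linear_lin_ext_comp[OF assms(2)]
    by (simp add: case_prod_beta \<phi>.scale \<psi>.scale mult.commute)
qed

lemma zero_if_functionals_zero:
  assumes "vector_space s" and "\<And>\<phi>. Vector_Spaces.linear s (*) \<phi> \<Longrightarrow> \<phi> v = 0"
  shows "v = 0"
proof -
  interpret vector_space s by fact
  let ?B = "extend_basis {}"
  have B: "independent ?B" "span ?B = UNIV"
    by (rule independent_extend_basis[OF independent_empty] span_extend_basis[OF independent_empty])+
  have "representation ?B v b = 0" for b
    by (rule assms(2)) (rule linear_representation[OF B])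
  then show ?thesis
    using sum_nonzero_representation_eq[OF B(1), of v] B(2) by simp
qed

lemma tensor_eq_refl: "tensor_eq sA sB x x"
  by (simp add: tensor_eq_def tensor_rels_def fscale.span_zero)

lemma tensor_eq_sym: "tensor_eq sA sB x y \<Longrightarrow> tensor_eq sA sB y x"
  using fscale.span_neg[of "x - y"] by (fastforce simp: tensor_eq_def tensor_rels_def)

lemma tensor_eq_trans:
  "tensor_eq sA sB x y \<Longrightarrow> tensor_eq sA sB y z \<Longrightarrow> tensor_eq sA sB x z"
  using fscale.span_add[of "x - y" _ "y - z"] by (simp add: tensor_eq_def tensor_rels_def)

lemma tensor_eq_add:
  "tensor_eq sA sB x x' \<Longrightarrow> tensor_eq sA sB y y' \<Longrightarrow> tensor_eq sA sB (x + y) (x' + y')"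
  using fscale.span_add[of "x - x'" _ "y - y'"]
  by (simp add: tensor_eq_def tensor_rels_def algebra_simps)

lemma tensor_eq_scale: "tensor_eq sA sB x y \<Longrightarrow> tensor_eq sA sB (fscale c x) (fscale c y)"
  using fscale.span_scale[of "x - y" _ c]
  by (simp add: tensor_eq_def tensor_rels_def fscale.scale_right_diff_distrib)

lemma tensor_eq_sum:
  "(\<And>i. i \<in> S \<Longrightarrow> tensor_eq sA sB (f i) (g i)) \<Longrightarrow> tensor_eq sA sB (sum f S) (sum g S)"
  by (induction S rule: infinite_finite_induct) (auto intro: tensor_eq_refl tensor_eq_add)

lemma tensor_eq_pure_add:
  shows "tensor_eq sA sB (pure (a + a', b)) (pure (a, b) + pure (a', b))"
    and "tensor_eq sA sB (pure (a, b + b')) (pure (a, b) + pure (a, b'))"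
  unfolding tensor_eq_def diff_diff_eq[symmetric] tensor_rels_def
  by (rule fscale.span_base, blast)+

lemma tensor_eq_pure_scale:
  shows "tensor_eq sA sB (pure (sA c a, b)) (fscale c (pure (a, b)))"
    and "tensor_eq sA sB (pure (a, sB c b)) (fscale c (pure (a, b)))"
  unfolding tensor_eq_def tensor_rels_def
  by (rule fscale.span_base, blast)+

lemma tensor_eq_pure_zero:
  shows "tensor_eq sA sB (pure (0, b)) 0" and "tensor_eq sA sB (pure (a, 0)) 0"
  using tensor_eq_pure_add(1)[of sA sB 0 0 b] tensor_eq_pure_add(2)[of sA sB a 0 0]
    fscale.span_neg[of "- pure (0, b)"] fscale.span_neg[of "- pure (a, 0)"]
  by (simp_all add: tensor_eq_def tensor_rels_def)

lemma tensor_eq_pure_sum: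
  shows "tensor_eq sA sB (pure (\<Sum>i\<in>S. sA (c i) (v i), b)) (\<Sum>i\<in>S. fscale (c i) (pure (v i, b)))"
    and "tensor_eq sA sB (pure (a, \<Sum>i\<in>S. sB (c i) (w i))) (\<Sum>i\<in>S. fscale (c i) (pure (a, w i)))"
  by (induction S rule: infinite_finite_induct)
    (auto simp: tensor_eq_pure_zero
      intro: tensor_eq_trans[OF tensor_eq_pure_add(1)] tensor_eq_trans[OF tensor_eq_pure_add(2)]
        tensor_eq_add tensor_eq_pure_scale)

lemma formal_sum_expansion:
  "x = (\<Sum>i\<in>Poly_Mapping.keys x. fscale (Poly_Mapping.lookup x i) (pure i))"
  by (rule poly_mapping_eqI)
    (auto simp: lookup_sum lookup_fscale lookup_single when_def in_keys_iff
      if_distrib[where f="(*) _"] cong: if_cong)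

text \<open>
  Expanding the first factors of a tensor in a basis collects the second factors into contractions
  with the coordinate functionals.
\<close>

lemma tensor_eq_basis_expansion:
  assumes A: "vector_space sA" and B: "vector_space sB"
    and indep: "\<not> module.dependent sA E" and span: "module.span sA E = UNIV"
  obtains F where "finite F" "F \<subseteq> E"
    "tensor_eq sA sB x
      (\<Sum>e\<in>F. pure (e, slice_left sB (\<lambda>v. module.representation sA E v e) x))"
proof -
  interpret A: vector_space sA by fact
  interpret B: vector_space sB by fact
  let ?r = "A.representation E" and ?K = "Poly_Mapping.keys x" and ?l = "Poly_Mapping.lookup x"
  define F where "F = (\<Union>i\<in>?K. {e. ?r (fst i) e \<noteq> 0})"
  have F: "finite F" "F \<subseteq> E"
    unfolding F_def by (auto simp: A.finite_representation dest: A.representation_ne_zero)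
  have expand: "tensor_eq sA sB (pure i) (\<Sum>e\<in>F. fscale (?r (fst i) e) (pure (e, snd i)))"
    if "i \<in> ?K" for i
  proof -
    have "(\<Sum>e\<in>F. sA (?r (fst i) e) e) = (\<Sum>e | ?r (fst i) e \<noteq> 0. sA (?r (fst i) e) e)"
      by (rule sum.mono_neutral_right) (use F that in \<open>auto simp: F_def\<close>)
    also have "\<dots> = fst i"
      using indep span by (simp add: A.sum_nonzero_representation_eq)
    finally show ?thesis
      using tensor_eq_pure_sum(1)[where S = F and b = "snd i" and c = "?r (fst i)" and v = "\<lambda>e. e"
          and sA = sA and sB = sB]
      by simp
  qed
  have "tensor_eq sA sB x
      (\<Sum>i\<in>?K. fscale (?l i) (\<Sum>e\<in>F. fscale (?r (fst i) e) (pure (e, snd i))))"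
    by (subst formal_sum_expansion[of x]) (intro tensor_eq_sum tensor_eq_scale expand)
  also have "(\<Sum>i\<in>?K. fscale (?l i) (\<Sum>e\<in>F. fscale (?r (fst i) e) (pure (e, snd i)))) =
      (\<Sum>e\<in>F. \<Sum>i\<in>?K. fscale (?l i * ?r (fst i) e) (pure (e, snd i)))"
    by (simp add: fscale.scale_sum_right) (rule sum.swap)
  finally have 1: "tensor_eq sA sB x \<dots>" .
  have 2: "tensor_eq sA sB (pure (e, slice_left sB (\<lambda>v. ?r v e) x))
      (\<Sum>i\<in>?K. fscale (?l i * ?r (fst i) e) (pure (e, snd i)))" for e
    using tensor_eq_pure_sum(2)[where S = ?K and a = e and c = "\<lambda>i. ?l i * ?r (fst i) e"
        and w = snd and sA = sA and sB = sB]
    by (simp add: slice_left_def lin_ext_def case_prod_beta)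
  show ?thesis
    by (rule that[OF F tensor_eq_trans[OF 1 tensor_eq_sum[OF tensor_eq_sym[OF 2]]]])
qed

text \<open>
  Contractions of \<open>\<Sum> v\<^sub>i \<otimes> w\<^sub>i\<close> are linear combinations of the \<open>v\<^sub>i\<close>, or of the \<open>w\<^sub>i\<close>.  For the
  converse, expand \<open>x\<close> in a basis of the first space that extends a basis of \<open>V\<close>.  The coefficient of
  each basis vector is a left contraction, so it lies in \<open>W\<close>.  If the basis vector is outside \<open>V\<close>,
  its coordinate functional \<open>\<phi>\<close> is zero on \<open>V\<close>, and the value of any functional \<open>\<psi>\<close> at the
  coefficient is the value of \<open>\<phi>\<close> at the right contraction with \<open>\<psi>\<close>, an element of \<open>V\<close>; hence the
  coefficient is zero.
\<close>

lemma tensor_sub_iff_slices: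
  assumes A: "vector_space sA" and B: "vector_space sB"
    and V: "module.subspace sA V" and W: "module.subspace sB W"
  shows "x \<in> tensor_sub sA sB V W \<longleftrightarrow>
    (\<forall>\<psi>. Vector_Spaces.linear sB (*) \<psi> \<longrightarrow> slice_right sA \<psi> x \<in> V) \<and>
    (\<forall>\<phi>. Vector_Spaces.linear sA (*) \<phi> \<longrightarrow> slice_left sB \<phi> x \<in> W)"
    (is "_ \<longleftrightarrow> ?slices")
proof
  interpret A: vector_space sA by fact
  interpret B: vector_space sB by fact
  {
    assume "x \<in> tensor_sub sA sB V W"
    then obtain y where y: "Poly_Mapping.keys y \<subseteq> V \<times> W" "tensor_eq sA sB x y"
      unfolding tensor_sub_def by blast
    have "slice_right sA \<psi> y \<in> V" for \<psi>
      unfolding slice_right_def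
      by (rule lin_ext_in_subspace[OF A V]) (use y(1) V in \<open>auto intro: A.subspace_scale\<close>)
    moreover have "slice_left sB \<phi> y \<in> W" for \<phi>
      unfolding slice_left_def
      by (rule lin_ext_in_subspace[OF B W]) (use y(1) W in \<open>auto intro: B.subspace_scale\<close>)
    ultimately show ?slices
      using slice_right_tensor_eq[OF A _ y(2)] slice_left_tensor_eq[OF B _ y(2)] by simp
  next
    assume slices: ?slices
    obtain E0 where E0: "E0 \<subseteq> V" "A.independent E0" "V \<subseteq> A.span E0"
      using A.maximal_independent_subset by blast
    define E where "E = A.extend_basis E0"
    have E: "A.independent E" "A.span E = UNIV" "E0 \<subseteq> E"
      unfolding E_def
      by (rule A.independent_extend_basis[OF E0(2)] A.span_extend_basis[OF E0(2)]
          A.extend_basis_superset[OF E0(2)])+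
    let ?c = "\<lambda>e v. A.representation E v e"
    have coord: "Vector_Spaces.linear sA (*) (?c e)" for e
      by (rule A.linear_representation[OF E(1,2)])
    obtain F where F: "finite F" "F \<subseteq> E"
      and exp: "tensor_eq sA sB x (\<Sum>e\<in>F. pure (e, slice_left sB (?c e) x))"
      using tensor_eq_basis_expansion[OF A B E(1,2)] .
    have "slice_left sB (?c e) x = 0" if "e \<notin> E0" for e
    proof (rule zero_if_functionals_zero[OF B])
      fix \<psi> assume \<psi>: "Vector_Spaces.linear sB (*) \<psi>"
      have "?c e v = 0" if "v \<in> V" for v
        using A.representation_extend[OF E(1) subsetD[OF E0(3) that] E(3)] \<open>e \<notin> E0\<close>
          A.representation_ne_zero[of E0 v e] by auto
      then show "\<psi> (slice_left sB (?c e) x) = 0"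
        using slices \<psi> by (simp add: functional_slice_swap[OF coord \<psi>])
    qed
    then have "tensor_eq sA sB (\<Sum>e\<in>F. pure (e, slice_left sB (?c e) x))
        (\<Sum>e\<in>F. if e \<in> E0 then pure (e, slice_left sB (?c e) x) else 0)"
      by (intro tensor_eq_sum) (auto intro: tensor_eq_refl tensor_eq_pure_zero)
    moreover have "Poly_Mapping.keys (\<Sum>e\<in>F. if e \<in> E0 then pure (e, slice_left sB (?c e) x) else 0)
        \<subseteq> V \<times> W"
      using E0(1) slices coord
      by (intro subset_trans[OF Poly_Mapping.keys_sum]) (auto split: if_splits)
    ultimately show "x \<in> tensor_sub sA sB V W"
      unfolding tensor_sub_def using tensor_eq_trans[OF exp] by blast
  }
qed


section \<open>Stable subspaces\<close>

text \<open>
  Since the operators are closed under composition, the orbit of \<open>X\<close> is mapped to itself, and so is its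
  span; since the identity is among them, the orbit contains \<open>X\<close>.
\<close>

lemma is_smallest_stable_span:
  assumes s: "vector_space s"
    and linear: "\<And>i. i \<in> I \<Longrightarrow> Vector_Spaces.linear s s (T i)"
    and comp: "\<And>i j. i \<in> I \<Longrightarrow> j \<in> I \<Longrightarrow> \<exists>k\<in>I. \<forall>v. T i (T j v) = T k v"
    and id: "\<exists>i\<in>I. \<forall>v. T i v = v"
  shows "is_smallest (\<lambda>V. (module.subspace s V \<and> (\<forall>i\<in>I. \<forall>v\<in>V. T i v \<in> V)) \<and> X \<subseteq> V)
    (module.span s (\<Union>i\<in>I. T i ` X))"
proof -
  interpret vector_space s by fact
  let ?O = "\<Union>i\<in>I. T i ` X"
  have "T i v \<in> span ?O" if i: "i \<in> I" and v: "v \<in> span ?O" for i v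
  proof -
    interpret T: Vector_Spaces.linear s s "T i" by (rule linear) fact
    have "T i ` ?O \<subseteq> ?O"
      using comp[OF i] by fastforce
    then have "span (T i ` ?O) \<subseteq> span ?O"
      by (rule span_mono)
    then show ?thesis
      using v by (auto simp: T.span_image)
  qed
  moreover obtain i where "i \<in> I" "\<forall>v. T i v = v"
    using id by blast
  then have "X \<subseteq> ?O"
    by (force intro!: bexI[of _ i])
  then have "X \<subseteq> span ?O"
    using span_superset by blast
  moreover have "span ?O \<subseteq> V" if "subspace V" "\<forall>i\<in>I. \<forall>v\<in>V. T i v \<in> V" "X \<subseteq> V" for V
    by (rule span_minimal) (use that in auto)
  ultimately show ?thesis
    unfolding is_smallest_def by auto
qed

lemma Least_is_smallest: "is_smallest P x \<Longrightarrow> (LEAST x. P x) = x"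
  unfolding is_smallest_def by (blast intro: Least_equality)

lemma is_smallest_mono:
  assumes "is_smallest (\<lambda>C. P C \<and> X \<subseteq> C) x" and "is_smallest (\<lambda>C. P C \<and> Y \<subseteq> C) y" and "X \<subseteq> Y"
  shows "x \<subseteq> y"
  using assms unfolding is_smallest_def by blast

lemma fin_dim_subspace:
  assumes "vector_space s" and "module.subspace s V" and "V \<subseteq> module.span s B" and "finite B"
  shows "fin_dim s V"
proof -
  interpret vector_space s by fact
  obtain C where C: "C \<subseteq> V" "independent C" "V \<subseteq> span C"
    using maximal_independent_subset by blast
  have "finite C"
    using independent_span_bound[OF assms(4) C(2)] C(1) assms(3) by blast
  moreover have "V = span C"
    using C span_minimal[OF C(1) assms(2)] by blast
  ultimately show ?thesis
    unfolding fin_dim_def by blast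
qed

text \<open>
  Local finiteness: if the whole orbit of each vector spans a finite-dimensional space, then by linearity
  the orbit of \<open>X\<close> lies in the sum of these spaces over a finite spanning set of \<open>X\<close>.
\<close>

lemma fin_dim_orbit_span:
  assumes s: "vector_space s"
    and linear: "\<And>i. i \<in> I \<Longrightarrow> Vector_Spaces.linear s s (T i)"
    and bound: "\<And>i b. i \<in> I \<Longrightarrow> T i b \<in> module.span s (K b)" "\<And>b. finite (K b)"
    and X: "fin_dim s X"
  shows "fin_dim s (module.span s (\<Union>i\<in>I. T i ` X))"
proof -
  interpret vector_space s by fact
  obtain B where B: "finite B" "X = span B"
    using X unfolding fin_dim_def by blast
  have "T i v \<in> span (\<Union>b\<in>B. K b)" if i: "i \<in> I" and v: "v \<in> X" for i v
  proof -
    interpret T: Vector_Spaces.linear s s "T i" by (rule linear) fact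
    have "T i v \<in> span (T i ` B)"
      using v by (auto simp: T.span_image B(2))
    moreover have "T i ` B \<subseteq> span (\<Union>b\<in>B. K b)"
      using bound(1)[OF i] span_mono[of _ "\<Union>b\<in>B. K b"] by blast
    ultimately show ?thesis
      using span_minimal by blast
  qed
  then have "span (\<Union>i\<in>I. T i ` X) \<subseteq> span (\<Union>b\<in>B. K b)"
    by (intro span_minimal) auto
  then show ?thesis
    by (rule fin_dim_subspace[OF s subspace_span]) (use B bound(2) in auto)
qed

section \<open>Translations by functionals on an affine group scheme\<close>

text \<open>This is why the opposite group acts by left translations.\<close>

lemma slice_right_tensor_swap:
  assumes "vector_space s"
  shows "slice_right s \<phi> (tensor_swap x) = slice_left s \<phi> x"
  unfolding slice_right_def slice_left_def tensor_swap_def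
    linear_lin_ext_comp[OF linear_lin_ext[OF assms]]
  by (simp add: case_prod_unfold lin_ext_pure[OF assms])

context affine_group_scheme
begin

abbreviation functionals :: "('a \<Rightarrow> 'k) set"
  where "functionals \<equiv> {\<phi>. Vector_Spaces.linear (scale G) (*) \<phi>}"

definition right_translate :: "('a \<Rightarrow> 'k) \<Rightarrow> 'a \<Rightarrow> 'a"
  where "right_translate \<phi> f = slice_right (scale G) \<phi> (comul G f)"

definition left_translate :: "('a \<Rightarrow> 'k) \<Rightarrow> 'a \<Rightarrow> 'a"
  where "left_translate \<phi> f = slice_left (scale G) \<phi> (comul G f)"

definition convolution :: "('a \<Rightarrow> 'k) \<Rightarrow> ('a \<Rightarrow> 'k) \<Rightarrow> 'a \<Rightarrow> 'k"
  where "convolution \<phi> \<psi> f = lin_ext (*) (\<lambda>(a, b). \<phi> a * \<psi> b) (comul G f)"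

lemma vs: "vector_space (scale G)"
  using algebra by (simp add: comm_algebra_def)

sublocale vector_space "scale G"
  by (rule vs)

lemma vs_field: "vector_space ((*) :: 'k \<Rightarrow> 'k \<Rightarrow> 'k)"
  by unfold_locales (simp_all add: algebra_simps)

lemma functional_add: "\<phi> \<in> functionals \<Longrightarrow> \<phi> (f + h) = \<phi> f + \<phi> h"
  and functional_scale: "\<phi> \<in> functionals \<Longrightarrow> \<phi> (scale G c f) = c * \<phi> f"
  by (simp_all add: Vector_Spaces.linear_iff)

lemma linear_lin_ext_comul:
  assumes "vector_space s" and "bilinear_on_pairs (scale G) (scale G) s T"
  shows "Vector_Spaces.linear (scale G) s (\<lambda>f. lin_ext s T (comul G f))"
proof -
  interpret T: Vector_Spaces.linear fscale s "lin_ext s T"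
    by (rule linear_lin_ext) fact
  note eq = lin_ext_tensor_eq[OF assms]
  show ?thesis
    unfolding Vector_Spaces.linear_iff
    using assms(1) vs by (simp add: eq[OF comul_add] eq[OF comul_scale] T.add T.scale)
qed

lemma linear_right_translate:
  "\<phi> \<in> functionals \<Longrightarrow> Vector_Spaces.linear (scale G) (scale G) (right_translate \<phi>)"
  unfolding right_translate_def[abs_def] slice_right_def
  by (intro linear_lin_ext_comul vs bilinear_slice_right) simp

lemma linear_left_translate:
  "\<phi> \<in> functionals \<Longrightarrow> Vector_Spaces.linear (scale G) (scale G) (left_translate \<phi>)"
  unfolding left_translate_def[abs_def] slice_left_def
  by (intro linear_lin_ext_comul vs bilinear_slice_left) simp

lemma convolution_functional:
  assumes "\<phi> \<in> functionals" and "\<psi> \<in> functionals"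
  shows "convolution \<phi> \<psi> \<in> functionals"
  unfolding convolution_def[abs_def] mem_Collect_eq
  by (intro linear_lin_ext_comul vs_field)
    (simp add: bilinear_on_pairs_def functional_add[OF assms(1)] functional_add[OF assms(2)]
        functional_scale[OF assms(1)] functional_scale[OF assms(2)] algebra_simps)

lemma counit_functional: "counit G \<in> functionals"
  using counit_hom by (simp add: algebra_hom_def)

lemma translate_counit: "right_translate (counit G) f = f" "left_translate (counit G) f = f"
  using counit_left counit_right
  by (simp_all add: right_translate_def left_translate_def slice_right_def slice_left_def)

text \<open>Coassociativity in the form in which it is used: after applying a trilinear map.\<close>

lemma coassoc_trilinear:
  assumes s: "vector_space s"
    and T: "trilinear_on_triples (scale G) (scale G) (scale G) s T"
  shows "lin_ext s (\<lambda>(a, b). lin_ext s (\<lambda>(a', a''). T (a', a'', b)) (comul G a)) (comul G f) =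
    lin_ext s (\<lambda>(a, b). lin_ext s (\<lambda>(b', b''). T (a, b', b'')) (comul G b)) (comul G f)"
  using lin_ext_tensor3_eq[OF s T coassoc[of f]]
  by (simp add: linear_lin_ext_comp[OF linear_lin_ext[OF s]] lin_ext_pure[OF s] case_prod_unfold)

text \<open>
  The next three identities rewrite an inner translate or convolution as the inner sum of
  \<open>coassoc_trilinear\<close>, whose outer sum supplies the scalar or the vector.
\<close>

lemma scale_right_translate:
  "scale G c (right_translate \<phi> a) = lin_ext (scale G) (\<lambda>(a', a''). scale G (c * \<phi> a'') a') (comul G a)"
  by (simp add: right_translate_def slice_right_def linear_lin_ext_comp[OF linear_scale_self]
      case_prod_unfold)

lemma scale_left_translate:
  "scale G c (left_translate \<phi> a) = lin_ext (scale G) (\<lambda>(a', a''). scale G (c * \<phi> a') a'') (comul G a)"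
  by (simp add: left_translate_def slice_left_def linear_lin_ext_comp[OF linear_scale_self]
      case_prod_unfold)

lemma scale_convolution:
  "scale G (convolution \<phi> \<psi> b) a =
    lin_ext (scale G) (\<lambda>(b', b''). scale G (\<phi> b' * \<psi> b'') a) (comul G b)"
proof -
  have "Vector_Spaces.linear (*) (scale G) (\<lambda>c. scale G c a)"
    by (simp add: Vector_Spaces.linear_iff vs vs_field scale_left_distrib)
  then show ?thesis
    unfolding convolution_def by (subst linear_lin_ext_comp) (auto simp: case_prod_unfold)
qed

lemma right_translate_lin_ext:
  assumes "\<phi> \<in> functionals"
  shows "right_translate \<phi> (lin_ext (scale G) h x) = lin_ext (scale G) (\<lambda>i. right_translate \<phi> (h i)) x"
  using linear_right_translate[OF assms] by (rule linear_lin_ext_comp)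

lemma left_translate_lin_ext:
  assumes "\<phi> \<in> functionals"
  shows "left_translate \<phi> (lin_ext (scale G) h x) = lin_ext (scale G) (\<lambda>i. left_translate \<phi> (h i)) x"
  using linear_left_translate[OF assms] by (rule linear_lin_ext_comp)

text \<open>
  Write \<open>\<Sum> f\<^sub>1 \<otimes> f\<^sub>2 \<otimes> f\<^sub>3\<close> for the iterated comultiplication of \<open>f\<close>.  Both sides of the next
  identity are \<open>\<Sum> \<phi> (f\<^sub>2) \<psi> (f\<^sub>3) f\<^sub>1\<close>; in the two identities after it, both sides are
  \<open>\<Sum> \<psi> (f\<^sub>1) \<phi> (f\<^sub>2) f\<^sub>3\<close> and \<open>\<Sum> \<phi> (f\<^sub>1) \<psi> (f\<^sub>3) f\<^sub>2\<close>.
\<close>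

lemma right_translate_right_translate:
  assumes \<phi>: "\<phi> \<in> functionals" and \<psi>: "\<psi> \<in> functionals"
  shows "right_translate \<phi> (right_translate \<psi> f) = right_translate (convolution \<phi> \<psi>) f"
proof -
  interpret R: Vector_Spaces.linear "scale G" "scale G" "right_translate \<phi>"
    by (rule linear_right_translate) fact
  have T: "trilinear_on_triples (scale G) (scale G) (scale G) (scale G)
      (\<lambda>(a, b, c). scale G (\<phi> b * \<psi> c) a)"
    by (simp add: trilinear_on_triples_def functional_add[OF \<phi>] functional_add[OF \<psi>]
        functional_scale[OF \<phi>] functional_scale[OF \<psi>]
        scale_right_distrib scale_left_distrib algebra_simps)
  have "right_translate \<phi> (right_translate \<psi> f) =
      lin_ext (scale G) (\<lambda>(a, b). scale G (\<psi> b) (right_translate \<phi> a)) (comul G f)"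
    unfolding right_translate_def[of \<psi>] slice_right_def right_translate_lin_ext[OF \<phi>]
    by (simp add: case_prod_unfold R.scale)
  also have "\<dots> = lin_ext (scale G) (\<lambda>(a, b). scale G (convolution \<phi> \<psi> b) a) (comul G f)"
    using coassoc_trilinear[OF vs T, of f]
    by (simp add: scale_right_translate scale_convolution mult.commute)
  finally show ?thesis
    by (simp add: right_translate_def[of "convolution \<phi> \<psi>"] slice_right_def)
qed

lemma left_translate_left_translate:
  assumes \<phi>: "\<phi> \<in> functionals" and \<psi>: "\<psi> \<in> functionals"
  shows "left_translate \<phi> (left_translate \<psi> f) = left_translate (convolution \<psi> \<phi>) f"
proof -
  interpret L: Vector_Spaces.linear "scale G" "scale G" "left_translate \<phi>"
    by (rule linear_left_translate) fact
  have T: "trilinear_on_triples (scale G) (scale G) (scale G) (scale G)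
      (\<lambda>(a, b, c). scale G (\<psi> a * \<phi> b) c)"
    by (simp add: trilinear_on_triples_def functional_add[OF \<phi>] functional_add[OF \<psi>]
        functional_scale[OF \<phi>] functional_scale[OF \<psi>]
        scale_right_distrib scale_left_distrib algebra_simps)
  have "left_translate \<phi> (left_translate \<psi> f) =
      lin_ext (scale G) (\<lambda>(a, b). scale G (\<psi> a) (left_translate \<phi> b)) (comul G f)"
    unfolding left_translate_def[of \<psi>] slice_left_def left_translate_lin_ext[OF \<phi>]
    by (simp add: case_prod_unfold L.scale)
  also have "\<dots> = lin_ext (scale G) (\<lambda>(a, b). scale G (convolution \<psi> \<phi> a) b) (comul G f)"
    using coassoc_trilinear[OF vs T, of f]
    by (simp add: scale_left_translate scale_convolution)
  finally show ?thesis
    by (simp add: left_translate_def[of "convolution \<psi> \<phi>"] slice_left_def)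
qed

lemma left_translate_right_translate:
  assumes \<phi>: "\<phi> \<in> functionals" and \<psi>: "\<psi> \<in> functionals"
  shows "left_translate \<phi> (right_translate \<psi> f) = right_translate \<psi> (left_translate \<phi> f)"
proof -
  interpret L: Vector_Spaces.linear "scale G" "scale G" "left_translate \<phi>"
    by (rule linear_left_translate) fact
  interpret R: Vector_Spaces.linear "scale G" "scale G" "right_translate \<psi>"
    by (rule linear_right_translate) fact
  have T: "trilinear_on_triples (scale G) (scale G) (scale G) (scale G)
      (\<lambda>(a, b, c). scale G (\<phi> a * \<psi> c) b)"
    by (simp add: trilinear_on_triples_def functional_add[OF \<phi>] functional_add[OF \<psi>]
        functional_scale[OF \<phi>] functional_scale[OF \<psi>]
        scale_right_distrib scale_left_distrib algebra_simps)
  have "left_translate \<phi> (right_translate \<psi> f) =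
      lin_ext (scale G) (\<lambda>(a, b). scale G (\<psi> b) (left_translate \<phi> a)) (comul G f)"
    unfolding right_translate_def slice_right_def left_translate_lin_ext[OF \<phi>]
    by (simp add: case_prod_unfold L.scale)
  also have "\<dots> = lin_ext (scale G) (\<lambda>(a, b). scale G (\<phi> a) (right_translate \<psi> b)) (comul G f)"
    using coassoc_trilinear[OF vs T, of f]
    by (simp add: scale_left_translate scale_right_translate mult.commute)
  also have "\<dots> = right_translate \<psi> (left_translate \<phi> f)"
    unfolding left_translate_def slice_left_def right_translate_lin_ext[OF \<psi>]
    by (simp add: case_prod_unfold R.scale)
  finally show ?thesis .
qed


section \<open>Submodules and subcoalgebras generated by a subspace\<close>

lemma regular_submodule_iff:
  "regular_submodule G V \<longleftrightarrow> subspace V \<and> (\<forall>\<phi>\<in>functionals. \<forall>f\<in>V. right_translate \<phi> f \<in> V)"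
  unfolding regular_submodule_def right_translate_def
  using tensor_sub_iff_slices[OF vs vs _ subspace_UNIV] by auto

lemma regular_submodule_opposite_iff:
  "regular_submodule (opposite G) V \<longleftrightarrow>
    subspace V \<and> (\<forall>\<phi>\<in>functionals. \<forall>f\<in>V. left_translate \<phi> f \<in> V)"
  unfolding regular_submodule_def left_translate_def opposite_def
  using tensor_sub_iff_slices[OF vs vs _ subspace_UNIV] by (auto simp: slice_right_tensor_swap[OF vs])

text \<open>
  With \<open>A\<close> the coordinate algebra, this rests on \<open>C \<otimes> C = (C \<otimes> A) \<inter> (A \<otimes> C)\<close>, which is contained
  in the description of a tensor product of subspaces by contractions.
\<close>

lemma subcoalgebra_iff:
  "subcoalgebra G C \<longleftrightarrow> regular_submodule G C \<and> regular_submodule (opposite G) C"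
  unfolding regular_submodule_iff regular_submodule_opposite_iff
  unfolding subcoalgebra_def right_translate_def left_translate_def
  using tensor_sub_iff_slices[OF vs vs] by auto

lemma is_smallest_submodule:
  "is_smallest (\<lambda>V. regular_submodule G V \<and> X \<subseteq> V)
    (span (\<Union>\<phi>\<in>functionals. right_translate \<phi> ` X))"
  unfolding regular_submodule_iff
proof (rule is_smallest_stable_span[OF vs linear_right_translate])
  show "\<exists>\<chi>\<in>functionals. \<forall>f. right_translate \<phi> (right_translate \<psi> f) = right_translate \<chi> f"
    if "\<phi> \<in> functionals" "\<psi> \<in> functionals" for \<phi> \<psi>
    using right_translate_right_translate[OF that] convolution_functional that by metis
  show "\<exists>\<phi>\<in>functionals. \<forall>f. right_translate \<phi> f = f"
    using counit_functional translate_counit by metis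
qed

lemma is_smallest_submodule_opposite:
  "is_smallest (\<lambda>V. regular_submodule (opposite G) V \<and> X \<subseteq> V)
    (span (\<Union>\<phi>\<in>functionals. left_translate \<phi> ` X))"
  unfolding regular_submodule_opposite_iff
proof (rule is_smallest_stable_span[OF vs linear_left_translate])
  show "\<exists>\<chi>\<in>functionals. \<forall>f. left_translate \<phi> (left_translate \<psi> f) = left_translate \<chi> f"
    if "\<phi> \<in> functionals" "\<psi> \<in> functionals" for \<phi> \<psi>
    using left_translate_left_translate[OF that] convolution_functional that by metis
  show "\<exists>\<phi>\<in>functionals. \<forall>f. left_translate \<phi> f = f"
    using counit_functional translate_counit by metis
qed

lemmas submodule_gen_eq = Least_is_smallest[OF is_smallest_submodule, folded submodule_gen_def]
lemmas submodule_gen_opposite_eq =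
  Least_is_smallest[OF is_smallest_submodule_opposite, folded submodule_gen_def]

text \<open>
  Right stability survives the passage to the span of the left translates because the two kinds of
  translations commute.
\<close>

lemma regular_submodule_left_translates:
  assumes "regular_submodule G V"
  shows "regular_submodule G (submodule_gen (opposite G) V)"
proof -
  let ?O = "\<Union>\<phi>\<in>functionals. left_translate \<phi> ` V"
  have "right_translate \<psi> f \<in> span ?O" if \<psi>: "\<psi> \<in> functionals" and f: "f \<in> span ?O" for \<psi> f
  proof -
    interpret R: Vector_Spaces.linear "scale G" "scale G" "right_translate \<psi>"
      by (rule linear_right_translate) fact
    have "right_translate \<psi> ` ?O \<subseteq> ?O"
      using assms \<psi>
      by (auto simp: regular_submodule_iff left_translate_right_translate[symmetric])
    then have "span (right_translate \<psi> ` ?O) \<subseteq> span ?O"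
      by (rule span_mono)
    then show ?thesis
      using f by (auto simp: R.span_image)
  qed
  then show ?thesis
    by (simp add: submodule_gen_opposite_eq regular_submodule_iff)
qed

lemma is_smallest_subcoalgebra:
  "is_smallest (\<lambda>C. subcoalgebra G C \<and> X \<subseteq> C) (submodule_gen (opposite G) (submodule_gen G X))"
proof -
  note right = is_smallest_submodule[of X, folded submodule_gen_eq]
  note left = is_smallest_submodule_opposite[of "submodule_gen G X", folded submodule_gen_opposite_eq]
  show ?thesis
    using right left regular_submodule_left_translates[of "submodule_gen G X"]
    unfolding is_smallest_def subcoalgebra_iff by blast
qed

lemmas subcoalgebra_gen_eq = Least_is_smallest[OF is_smallest_subcoalgebra, folded subcoalgebra_gen_def]

text \<open>The bounds do not depend on \<open>\<phi>\<close>; this is the source of finite-dimensionality.\<close>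

lemma right_translate_bounded: "right_translate \<phi> f \<in> span (fst ` Poly_Mapping.keys (comul G f))"
  unfolding right_translate_def slice_right_def
  by (rule lin_ext_in_subspace[OF vs subspace_span]) (force intro: span_scale span_base)

lemma left_translate_bounded: "left_translate \<phi> f \<in> span (snd ` Poly_Mapping.keys (comul G f))"
  unfolding left_translate_def slice_left_def
  by (rule lin_ext_in_subspace[OF vs subspace_span]) (force intro: span_scale span_base)

lemma fin_dim_subcoalgebra_gen:
  assumes "fin_dim (scale G) X"
  shows "fin_dim (scale G) (subcoalgebra_gen G X)"
  unfolding subcoalgebra_gen_eq submodule_gen_opposite_eq
proof (rule fin_dim_orbit_span[OF vs linear_left_translate left_translate_bounded])
  show "fin_dim (scale G) (submodule_gen G X)"
    unfolding submodule_gen_eq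
    by (rule fin_dim_orbit_span[OF vs linear_right_translate right_translate_bounded]) (simp_all add: assms)
qed simp_all

end

theorem theorem3p1:
  fixes G :: "('k::field, 'a::comm_ring_1) group_scheme" and p :: nat
  assumes "CHAR('k) = p" and "p > 0"
    and "affine_group_scheme G" and "finite_type G"
  shows "(\<forall>X. module.subspace (scale G) X \<longrightarrow>
        is_smallest (\<lambda>C. subcoalgebra G C \<and> X \<subseteq> C) (subcoalgebra_gen G X) \<and>
        subcoalgebra_gen G X = submodule_gen (opposite G) (submodule_gen G X) \<and>
        (fin_dim (scale G) X \<longrightarrow> fin_dim (scale G) (subcoalgebra_gen G X)))
    \<and> (\<forall>X. ascending_converging G X \<and> (\<forall>i. fin_dim (scale G) (X i)) \<longrightarrow>
        is_smallest
          (\<lambda>C. ascending_converging G C \<and>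
            (\<forall>i. subcoalgebra G (C i) \<and> fin_dim (scale G) (C i) \<and> X i \<subseteq> C i))
          (\<lambda>i. subcoalgebra_gen G (X i)))"
proof -
  interpret affine_group_scheme G by fact
  have smallest: "is_smallest (\<lambda>C. subcoalgebra G C \<and> X \<subseteq> C) (subcoalgebra_gen G X)" for X
    unfolding subcoalgebra_gen_eq by (rule is_smallest_subcoalgebra)
  then have gen: "subcoalgebra G (subcoalgebra_gen G X)" "X \<subseteq> subcoalgebra_gen G X" for X
    by (simp_all add: is_smallest_def)
  have seq: "is_smallest
      (\<lambda>C. ascending_converging G C \<and>
        (\<forall>i. subcoalgebra G (C i) \<and> fin_dim (scale G) (C i) \<and> X i \<subseteq> C i))
      (\<lambda>i. subcoalgebra_gen G (X i))"
    if X: "ascending_converging G X" "\<forall>i. fin_dim (scale G) (X i)" for X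
  proof -
    have "subcoalgebra_gen G (X i) \<subseteq> subcoalgebra_gen G (X (Suc i))" for i
      using X(1) by (intro is_smallest_mono[OF smallest smallest]) (simp add: ascending_converging_def)
    moreover have "(\<Union>i. subcoalgebra_gen G (X i)) = UNIV"
      using X(1) gen(2) unfolding ascending_converging_def by blast
    ultimately have "ascending_converging G (\<lambda>i. subcoalgebra_gen G (X i))"
      using gen(1) by (simp add: ascending_converging_def subcoalgebra_def)
    moreover have "subcoalgebra_gen G (X i) \<subseteq> C i" if "\<forall>i. subcoalgebra G (C i) \<and> X i \<subseteq> C i" for C i
      using smallest[of "X i"] that unfolding is_smallest_def by blast
    ultimately show ?thesis
      using X(2) gen fin_dim_subcoalgebra_gen unfolding is_smallest_def le_fun_def by blast
  qed
  show ?thesis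
    using smallest subcoalgebra_gen_eq fin_dim_subcoalgebra_gen seq by blast
qed

end
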